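(* Let $T\in\mathrm{Diff}_2(\mathcal Q)$ be an exceptional operator, $\mathcal U$ its maximal invariant polynomial subspace, and $\nu$ the codimension of $\mathcal U$ in $\mathcal P$. For $\zeta\in\mathbb C$ we have $\nu_\zeta>0$ if and only if $\zeta$ is a pole of $T$. Moreover, if $\zeta_1,\ldots,\zeta_N$ are the poles of $T$ and $\nu_i=\nu_{\zeta_i}$, then $$\nu=\sum_{i=1}^N\nu_i .$$
   Context: $\mathcal P=\mathbb C[z]$, $\mathcal Q=\mathbb C(z)$, $\mathbb N=\{0,1,2,\ldots\}$; $\mathrm{Diff}_2(\mathcal Q)$ is the set of operators $T=p(z)D_{zz}+q(z)D_z+r(z)$ with $p,q,r\in\mathcal Q$, $p\ne0$. $T$ is exceptional if there is a finite set $\{k_1,\ldots,k_m\}\subset\mathbb N$ ($m=0$ allowed) such that for every $k\in\mathbb N\setminus\{k_1,\ldots,k_m\}$ there is a polynomial $y_k$ of degree exactly $k$ and $\lambda_k\in\mathbb C$ with $T[y_k]=\lambda_ky_k$, and no such polynomial exists for $k\in\{k_1,\ldots,k_m\}$. The maximal invariant polynomial subspace $\mathcal U\subset\mathcal P$ of $T$ is the largest subspace of $\mathcal P$ with $T[\mathcal U]\subset\mathcal U$. For $\zeta\in\mathbb C$, $\mathrm{ord}_\zeta y$ is the order of vanishing of $y$ at $\zeta$, $I_\zeta=\{\mathrm{ord}_\zeta y: y\in\mathcal U,\ y\neq0\}$, and $\nu_\zeta$ is the cardinality of $\mathbb N\setminus I_\zeta$. A point $\zeta\in\mathbb C$ is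 a pole of $T$ if it is a pole of at least one of $p,q,r$. *)

theory Defs
  imports Complex_Main "HOL-Computational_Algebra.Computational_Algebra"
    "HOL-Computational_Algebra.Field_as_Ring"
begin

interpretation cpoly: vector_space "smult :: complex \<Rightarrow> complex poly \<Rightarrow> complex poly"
  by unfold_locales (simp_all add: smult_add_right smult_add_left)

text \<open>
  An operator \<open>p D\<^sub>z\<^sub>z + q D\<^sub>z + r\<close> is given by its coefficients in \<open>\<complex>(z)\<close>, which are uniquely
  determined by it.
\<close>

datatype diff_op =
  Diff_Op (coeff2: "complex poly fract") (coeff1: "complex poly fract") (coeff0: "complex poly fract")

definition Diff2 :: "diff_op set" where
  "Diff2 = {T. coeff2 T \<noteq> 0}"

text \<open>Only the action on polynomials is needed; its values are rational functions in general.\<close>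

definition app_op :: "diff_op \<Rightarrow> complex poly \<Rightarrow> complex poly fract" where
  "app_op T y = coeff2 T * to_fract (pderiv (pderiv y)) + coeff1 T * to_fract (pderiv y)
     + coeff0 T * to_fract y"

text \<open>\<open>y \<noteq> 0\<close> is needed because \<open>degree 0 = 0\<close>.\<close>

definition has_eigenpoly :: "diff_op \<Rightarrow> nat \<Rightarrow> bool" where
  "has_eigenpoly T k \<longleftrightarrow>
     (\<exists>y c. y \<noteq> 0 \<and> degree y = k \<and> app_op T y = to_fract (smult c y))"

definition exceptional :: "diff_op \<Rightarrow> bool" where
  "exceptional T \<longleftrightarrow> (\<exists>K. finite K \<and> (\<forall>k. k \<notin> K \<longleftrightarrow> has_eigenpoly T k))"

definition invariant_poly_subspace :: "diff_op \<Rightarrow> complex poly set \<Rightarrow> bool" where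
  "invariant_poly_subspace T V \<longleftrightarrow> cpoly.subspace V \<and> app_op T ` V \<subseteq> to_fract ` V"

definition max_invariant_subspace :: "diff_op \<Rightarrow> complex poly set" where
  "max_invariant_subspace T = (GREATEST V. invariant_poly_subspace T V)"

text \<open>The maximum exists for every operator: it is the sum of all invariant subspaces.\<close>

lemma app_op_add: "app_op T (x + y) = app_op T x + app_op T y"
  by (simp add: app_op_def pderiv_add algebra_simps)

lemma app_op_smult: "app_op T (smult c x) = to_fract [:c:] * app_op T x"
proof -
  have "to_fract (smult c u) = to_fract [:c:] * to_fract u" for u :: "complex poly"
    by (simp flip: to_fract_mult)
  then show ?thesis
    by (simp add: app_op_def pderiv_smult algebra_simps)
qed

lemma max_invariant_subspace:
  "invariant_poly_subspace T (max_invariant_subspace T)"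
  "invariant_poly_subspace T V \<Longrightarrow> V \<subseteq> max_invariant_subspace T"
proof -
  define A where "A = \<Union> {V. invariant_poly_subspace T V}"
  have "app_op T x \<in> to_fract ` cpoly.span A" if "x \<in> cpoly.span A" for x
    using that
  proof (induction rule: cpoly.span_induct_alt)
    case base
    have "app_op T 0 = to_fract 0"
      by (simp add: app_op_def)
    then show ?case
      using cpoly.span_zero by blast
  next
    case (step c x y)
    obtain V where V: "invariant_poly_subspace T V" "x \<in> V"
      using step by (auto simp: A_def)
    then obtain u where u: "u \<in> V" "app_op T x = to_fract u"
      by (auto simp: invariant_poly_subspace_def)
    have uA: "u \<in> cpoly.span A"
      using V u by (auto simp: A_def intro: cpoly.span_base)
    obtain w where w: "w \<in> cpoly.span A" "app_op T y = to_fract w"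
      using step by auto
    have "app_op T (smult c x + y) = to_fract (smult c u + w)"
      by (simp add: app_op_add app_op_smult u w flip: to_fract_mult to_fract_add)
    then show ?case
      using uA w cpoly.span_add cpoly.span_scale by blast
  qed
  then have inv: "invariant_poly_subspace T (cpoly.span A)"
    by (auto simp: invariant_poly_subspace_def)
  have ge: "V \<subseteq> cpoly.span A" if "invariant_poly_subspace T V" for V
    using that by (auto simp: A_def intro: cpoly.span_base)
  have "max_invariant_subspace T = cpoly.span A"
    unfolding max_invariant_subspace_def using inv ge by (intro Greatest_equality) auto
  then show "invariant_poly_subspace T (max_invariant_subspace T)"
    "invariant_poly_subspace T V \<Longrightarrow> V \<subseteq> max_invariant_subspace T"
    using inv ge by auto
qed

text \<open>
  \<open>U\<close> has finite codimension \<open>n\<close> in \<open>\<complex>[z]\<close>: there are \<open>n\<close> polynomials, forming a basis of a complement of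
  \<open>U\<close>, i.e. whose classes form a basis of the quotient of \<open>\<complex>[z]\<close> by \<open>U\<close>.
\<close>

definition has_codim :: "complex poly set \<Rightarrow> nat \<Rightarrow> bool" where
  "has_codim U n \<longleftrightarrow>
     (\<exists>B. finite B \<and> card B = n \<and> cpoly.independent B \<and> cpoly.span B \<inter> U = {0} \<and>
          (\<forall>f. \<exists>b\<in>cpoly.span B. f - b \<in> U))"

definition order_set :: "diff_op \<Rightarrow> complex \<Rightarrow> nat set" where
  "order_set T \<zeta> = {order \<zeta> y | y. y \<in> max_invariant_subspace T \<and> y \<noteq> 0}"

text \<open>
  The set of gaps is finite whenever \<open>max_invariant_subspace T\<close> has finite codimension, so that \<open>card\<close> has
  its usual meaning.
\<close>

definition nu :: "diff_op \<Rightarrow> complex \<Rightarrow> nat" where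
  "nu T \<zeta> = card (UNIV - order_set T \<zeta>)"

text \<open>\<open>quot_of_fract\<close> yields numerator and denominator in lowest terms.\<close>

definition fract_pole :: "complex poly fract \<Rightarrow> complex \<Rightarrow> bool" where
  "fract_pole f \<zeta> \<longleftrightarrow> poly (snd (quot_of_fract f)) \<zeta> = 0"

definition poles :: "diff_op \<Rightarrow> complex set" where
  "poles T = {\<zeta>. fract_pole (coeff2 T) \<zeta> \<or> fract_pole (coeff1 T) \<zeta> \<or> fract_pole (coeff0 T) \<zeta>}"

lemma finite_poles: "finite (poles T)"
proof -
  have "finite {\<zeta>. fract_pole f \<zeta>}" for f
    unfolding fract_pole_def by (intro poly_roots_finite snd_quot_of_fract_nonzero)
  then show ?thesis
    by (simp add: poles_def Collect_disj_eq)
qed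

end

theory Submission
  imports Defs
begin

text \<open>
  Write \<open>U\<close> for the maximal invariant polynomial subspace and \<open>h\<close> for the product of the linear factors
  \<open>z - \<zeta>\<close> over the poles \<open>\<zeta>\<close> of \<open>T\<close>. A polynomial \<open>y\<close> lies in \<open>U\<close> iff all iterates \<open>y\<close>, \<open>T[y]\<close>,
  \<open>T[T[y]]\<close>, \<dots> are polynomials (\<open>max_invariant_subspace_eq_Inter\<close>). Being a polynomial is a local
  condition at each of the poles, so \<open>U\<close> should be an intersection of conditions, each of them living at a
  single pole. The proof makes this precise by means of two properties of \<open>U\<close>.

  First, \<open>U\<close> contains an ideal \<open>(h\<^sup>n)\<close> (\<open>max_invariant_subspace_contains_ideal\<close>). The eigenpolynomials
  lie in \<open>U\<close> and have all degrees but finitely many, so \<open>U\<close> has finite codimension and the decreasing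
  chain \<open>U + (h\<^sup>N)\<close> becomes stationary, at \<open>N = n\<close> say. Given a multiple \<open>f\<close> of \<open>h\<^sup>n\<close> and an iterate
  \<open>T\<^sup>j\<close>, one can therefore subtract an element of \<open>U\<close> from \<open>f\<close> so that the difference is divisible by a
  power of \<open>h\<close> so high that \<open>T\<^sup>j\<close> cannot create poles. Hence \<open>T\<^sup>j[f]\<close> is a polynomial for all \<open>j\<close>.

  Secondly, \<open>U\<close> is stable under multiplication by every \<open>e\<close> that is congruent to a constant modulo
  \<open>(z - \<zeta>)\<^sup>n\<close> for each pole \<open>\<zeta>\<close> (\<open>max_invariant_subspace_mult_locally_constant\<close>): if \<open>e\<close> is constant
  to very high order at all poles, then \<open>T[e y]\<close> and \<open>e T[y]\<close> differ by a multiple of a high power of \<open>h\<close>.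

  By the Chinese remainder theorem the second property applies to the idempotents of \<open>\<complex>[z]/(h\<^sup>n)\<close>,
  so \<open>U/(h\<^sup>n)\<close> splits into its parts at the single poles. At one pole \<open>\<zeta>\<close>, the powers \<open>(z - \<zeta>)\<^sup>k\<close> with
  \<open>k\<close> not an order of an element of \<open>U\<close> represent a basis of the quotient; multiplied by the idempotents and
  collected over all poles, they span a complement of \<open>U\<close>, which gives the formula for the codimension
  (\<open>has_codim_sum_local_gaps\<close>).

  At a point that is not a pole, multiples of \<open>h\<^sup>n\<close> show that there are no gaps. Conversely, if there are
  no gaps at \<open>\<zeta>\<close>, then \<open>U\<close> has elements of orders \<open>0\<close>, \<open>1\<close> and \<open>2\<close> at \<open>\<zeta>\<close>; their Wronskian does not
  vanish there, and solving for the coefficients of \<open>T\<close> by Cramer's rule shows that these are regular at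
  \<open>\<zeta>\<close> (\<open>not_pole_if_orders_0_1_2\<close>).
\<close>

section \<open>Powers of linear factors\<close>

abbreviation lin :: "complex \<Rightarrow> complex poly" where
  "lin \<zeta> \<equiv> [:- \<zeta>, 1:]"

abbreviation node_poly :: "complex set \<Rightarrow> complex poly" where
  "node_poly Z \<equiv> (\<Prod>\<zeta>\<in>Z. lin \<zeta>)"

lemma coprime_lin_power:
  assumes "poly f \<zeta> \<noteq> 0"
  shows "coprime (lin \<zeta> ^ n) f"
proof -
  have "prime_elem (lin \<zeta>)"
    by (intro prime_elem_linear_poly) auto
  moreover have "\<not> lin \<zeta> dvd f"
    using assms by (simp add: poly_eq_0_iff_dvd)
  ultimately have "coprime (lin \<zeta>) f"
    by (intro prime_elem_imp_coprime) auto
  then show ?thesis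
    by simp
qed

lemma order_lin_power_mult:
  assumes "poly g \<zeta> \<noteq> 0"
  shows "order \<zeta> (lin \<zeta> ^ n * g) = n"
proof -
  have "g \<noteq> 0"
    using assms by auto
  then have "lin \<zeta> ^ n * g \<noteq> 0"
    by simp
  then show ?thesis
    by (simp only: order_mult[OF \<open>lin \<zeta> ^ n * g \<noteq> 0\<close>] order_power_n_n order_0I[OF assms] add_0_right)
qed

lemma poly_node_poly_eq_0_iff:
  "finite Z \<Longrightarrow> poly (node_poly Z) \<zeta> = 0 \<longleftrightarrow> \<zeta> \<in> Z"
  by (auto simp: poly_prod)

lemma node_poly_power_dvd:
  assumes "finite Z" and "\<And>\<zeta>. \<zeta> \<in> Z \<Longrightarrow> lin \<zeta> ^ n dvd f"
  shows "node_poly Z ^ n dvd f"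
  using assms
proof (induction Z rule: finite_induct)
  case (insert \<zeta> Z)
  have "coprime (lin \<zeta> ^ n) (node_poly Z ^ n)"
    using insert by (intro coprime_lin_power) (simp add: poly_node_poly_eq_0_iff poly_power)
  moreover have "lin \<zeta> ^ n dvd f" "node_poly Z ^ n dvd f"
    using insert by auto
  ultimately have "lin \<zeta> ^ n * node_poly Z ^ n dvd f"
    by (intro divides_mult)
  then show ?case
    by (simp only: prod.insert[OF insert.hyps(1,2)] power_mult_distrib)
qed simp

lemma lin_power_dvd_node_poly_power:
  "finite Z \<Longrightarrow> \<zeta> \<in> Z \<Longrightarrow> lin \<zeta> ^ n dvd node_poly Z ^ n"
  by (intro dvd_power_same dvd_prodI)

lemma chinese_remainder_lin:
  assumes "finite Z"
  shows "\<exists>e. \<forall>\<zeta>\<in>Z. lin \<zeta> ^ n dvd e - f \<zeta>"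
  using assms
proof (induction Z rule: finite_induct)
  case (insert \<zeta> Z)
  then obtain e where e: "\<And>\<omega>. \<omega> \<in> Z \<Longrightarrow> lin \<omega> ^ n dvd e - f \<omega>"
    by blast
  define a where "a = node_poly Z ^ n"
  define b where "b = lin \<zeta> ^ n"
  have "coprime b a"
    unfolding a_def b_def using insert
    by (intro coprime_lin_power) (simp add: poly_node_poly_eq_0_iff poly_power)
  then obtain u v where uv: "u * a + v * b = 1"
    by (metis bezout_coefficients_fst_snd coprime_imp_gcd_eq_1 gcd.commute)
  define e' where "e' = e + (f \<zeta> - e) * (u * a)"
  have "lin \<omega> ^ n dvd e' - f \<omega>" if "\<omega> \<in> insert \<zeta> Z" for \<omega>
  proof (cases "\<omega> = \<zeta>")
    case True
    have "e' - f \<zeta> = (e - f \<zeta>) * (1 - u * a)"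
      by (simp add: e'_def algebra_simps)
    also have "1 - u * a = v * b"
      using uv by (simp add: algebra_simps)
    finally show ?thesis
      using True by (simp add: b_def)
  next
    case False
    then have "lin \<omega> ^ n dvd a"
      using that insert unfolding a_def by (intro lin_power_dvd_node_poly_power) auto
    moreover have "e' - f \<omega> = (e - f \<omega>) + (f \<zeta> - e) * u * a"
      by (simp add: e'_def algebra_simps)
    ultimately show ?thesis
      using e[of \<omega>] that False by (metis dvd_add dvd_mult insertE)
  qed
  then show ?case
    by blast
qed simp

lemma power_dvd_pderiv:
  assumes "d ^ Suc n dvd y"
  shows "d ^ n dvd pderiv (y :: complex poly)"
proof -
  obtain g where "y = d ^ Suc n * g"
    using assms by (elim dvdE)
  then have "pderiv y = d ^ Suc n * pderiv g + g * (smult (of_nat (Suc n)) (d ^ n) * pderiv d)"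
    by (simp only: pderiv_mult pderiv_power_Suc)
  also have "\<dots> = d ^ n * (d * pderiv g + smult (of_nat (Suc n)) (g * pderiv d))"
    by (simp add: algebra_simps del: of_nat_Suc)
  finally show ?thesis
    by simp
qed

section \<open>Codimension of a subspace given by local conditions\<close>

definition local_gaps :: "complex poly set \<Rightarrow> complex \<Rightarrow> nat set" where
  "local_gaps U \<zeta> = - {order \<zeta> y | y. y \<in> U \<and> y \<noteq> 0}"

text \<open>
  The two hypotheses say that \<open>U\<close> is the preimage of a subspace of \<open>\<complex>[z]/(h\<^sup>n)\<close>, with \<open>h\<close> the node
  polynomial, which is a direct sum of subspaces of the local factors \<open>\<complex>[z]/(z - \<zeta>)\<^sup>n\<close>. The complement
  constructed here has the basis \<open>e\<^sub>\<zeta> (z - \<zeta>)\<^sup>k\<close>, where \<open>e\<^sub>\<zeta>\<close> is the idempotent belonging to \<open>\<zeta>\<close> and \<open>k\<close>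
  is a gap at \<open>\<zeta>\<close>. Multiplication by \<open>e\<^sub>\<zeta>\<close> isolates the contribution of \<open>\<zeta>\<close>; there, a nontrivial
  combination has a gap as its order and so is not in \<open>U\<close>, while every polynomial is reduced to one of
  order at least \<open>n\<close> by removing its lowest term with a basis element or with an element of \<open>U\<close>.
\<close>

theorem has_codim_sum_local_gaps:
  fixes U :: "complex poly set"
  assumes fin: "finite Z" and sub: "cpoly.subspace U"
    and ideal: "\<And>f. node_poly Z ^ n dvd f \<Longrightarrow> f \<in> U"
    and mult: "\<And>e y. y \<in> U \<Longrightarrow> (\<And>\<zeta>. \<zeta> \<in> Z \<Longrightarrow> \<exists>c. lin \<zeta> ^ n dvd e - [:c:]) \<Longrightarrow> e * y \<in> U"
  shows "has_codim U (\<Sum>\<zeta>\<in>Z. card (local_gaps U \<zeta>))"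
    and "\<And>\<zeta>. \<zeta> \<in> Z \<Longrightarrow> finite (local_gaps U \<zeta>)"
    and "\<And>\<zeta>. \<zeta> \<notin> Z \<Longrightarrow> local_gaps U \<zeta> = {}"
proof -
  have ord: "k \<notin> local_gaps U \<zeta>" if "lin \<zeta> ^ k * g \<in> U" "poly g \<zeta> \<noteq> 0" for k g \<zeta>
  proof -
    define y where "y = lin \<zeta> ^ k * g"
    have "y \<in> U" "y \<noteq> 0" "order \<zeta> y = k"
      using that order_lin_power_mult[of g \<zeta> k] by (auto simp: y_def)
    then show ?thesis
      by (auto simp: local_gaps_def)
  qed
  show no_gaps: "local_gaps U \<zeta> = {}" if "\<zeta> \<notin> Z" for \<zeta>
  proof -
    have "k \<notin> local_gaps U \<zeta>" for k
      using that fin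
      by (intro ord[of _ _ "node_poly Z ^ n"] ideal) (auto simp: poly_node_poly_eq_0_iff poly_power)
    then show ?thesis
      by blast
  qed
  have bound: "k < n" if "k \<in> local_gaps U \<zeta>" "\<zeta> \<in> Z" for k \<zeta>
  proof (rule ccontr)
    assume "\<not> k < n"
    then have k: "lin \<zeta> ^ k = lin \<zeta> ^ n * lin \<zeta> ^ (k - n)"
      by (simp flip: power_add)
    have Z: "node_poly Z = lin \<zeta> * node_poly (Z - {\<zeta>})"
      using that fin by (intro prod.remove)
    have "lin \<zeta> ^ k * node_poly (Z - {\<zeta>}) ^ n \<in> U"
      by (rule ideal, simp only: k Z power_mult_distrib) (intro mult_dvd_mono dvd_triv_left dvd_refl)
    moreover have "poly (node_poly (Z - {\<zeta>}) ^ n) \<zeta> \<noteq> 0"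
      using fin by (simp add: poly_node_poly_eq_0_iff poly_power)
    ultimately show False
      using ord that by blast
  qed
  show fin_gaps: "finite (local_gaps U \<zeta>)" if "\<zeta> \<in> Z" for \<zeta>
    using bound that by (intro finite_subset[of "local_gaps U \<zeta>" "{..<n}"]) auto

  \<comment> \<open>The idempotents: \<open>e \<zeta>\<close> is \<open>1\<close> at \<open>\<zeta>\<close> and \<open>0\<close> at the other nodes, to order \<open>n\<close>.\<close>
  have "\<exists>e. \<forall>\<omega>\<in>Z. lin \<omega> ^ n dvd e - (if \<omega> = \<zeta> then 1 else 0)" for \<zeta>
    by (rule chinese_remainder_lin[OF fin])
  then obtain e where e: "\<And>\<zeta> \<omega>. \<omega> \<in> Z \<Longrightarrow> lin \<omega> ^ n dvd e \<zeta> - (if \<omega> = \<zeta> then 1 else 0)"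
    by metis
  have e_self: "lin \<zeta> ^ n dvd e \<zeta> - 1" if "\<zeta> \<in> Z" for \<zeta>
    using e[of \<zeta> \<zeta>] that by simp
  have e_other: "lin \<omega> ^ n dvd e \<zeta>" if "\<omega> \<in> Z" "\<omega> \<noteq> \<zeta>" for \<zeta> \<omega>
    using e[of \<omega> \<zeta>] that by simp
  have e_mult: "e \<zeta> * y \<in> U" if "y \<in> U" for \<zeta> y
  proof (rule mult[OF that])
    fix \<omega> assume "\<omega> \<in> Z"
    then show "\<exists>c. lin \<omega> ^ n dvd e \<zeta> - [:c:]"
      using e[of \<omega> \<zeta>] by (cases "\<omega> = \<zeta>") (auto simp: one_pCons intro: exI[of _ 1] exI[of _ 0])
  qed

  define A where "A = (SIGMA \<zeta>:Z. local_gaps U \<zeta>)"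
  define b where "b = (\<lambda>(\<zeta>, k). e \<zeta> * lin \<zeta> ^ k)"
  have finA: "finite A"
    unfolding A_def using fin fin_gaps by auto
  \<comment> \<open>This contains the linear independence of the family \<open>b\<close> as well as the trivial intersection of its
    span with \<open>U\<close>, and also the injectivity of \<open>b\<close>, which is needed to count its values.\<close>
  have indep: "c (\<zeta>, k) = 0"
    if s: "(\<Sum>x\<in>A. smult (c x) (b x)) \<in> U" and \<zeta>: "\<zeta> \<in> Z" and k: "k \<in> local_gaps U \<zeta>" for c \<zeta> k
  proof (rule ccontr)
    assume "c (\<zeta>, k) \<noteq> 0"
    define g where "g \<omega> = (\<Sum>k\<in>local_gaps U \<omega>. smult (c (\<omega>, k)) (lin \<omega> ^ k))" for \<omega>
    define s where "s = (\<Sum>\<omega>\<in>Z. e \<omega> * g \<omega>)"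
    have "(\<Sum>x\<in>A. smult (c x) (b x)) = (\<Sum>(\<omega>, k)\<in>A. e \<omega> * smult (c (\<omega>, k)) (lin \<omega> ^ k))"
      by (rule sum.cong) (auto simp: b_def)
    also have "\<dots> = s"
      using fin fin_gaps unfolding A_def s_def g_def sum_distrib_left by (subst sum.Sigma) auto
    finally have s_eq: "(\<Sum>x\<in>A. smult (c x) (b x)) = s" .
    \<comment> \<open>Multiplication by \<open>e \<zeta>\<close> extracts the part \<open>g \<zeta>\<close> of the combination at \<open>\<zeta>\<close>.\<close>
    have "node_poly Z ^ n dvd e \<zeta> * s - e \<zeta> * g \<zeta>"
    proof (rule node_poly_power_dvd[OF fin])
      fix \<omega> assume \<omega>: "\<omega> \<in> Z"
      show "lin \<omega> ^ n dvd e \<zeta> * s - e \<zeta> * g \<zeta>"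
      proof (cases "\<omega> = \<zeta>")
        case True
        have "s - g \<zeta> = (e \<zeta> - 1) * g \<zeta> + (\<Sum>\<xi>\<in>Z - {\<zeta>}. e \<xi> * g \<xi>)"
          using fin \<zeta> by (simp add: s_def sum.remove[of Z \<zeta>] algebra_simps)
        moreover have "lin \<omega> ^ n dvd (\<Sum>\<xi>\<in>Z - {\<zeta>}. e \<xi> * g \<xi>)"
          using \<omega> True by (intro dvd_sum dvd_mult2 e_other) auto
        ultimately have "lin \<omega> ^ n dvd s - g \<zeta>"
          using True e_self[OF \<zeta>] by (metis dvd_add dvd_mult2)
        then show ?thesis
          by (simp flip: right_diff_distrib)
      next
        case False
        then show ?thesis
          using e_other[OF \<omega>] by (intro dvd_diff dvd_mult2) auto
      qed
    qed
    then have "e \<zeta> * s - (e \<zeta> * s - e \<zeta> * g \<zeta>) \<in> U"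
      using s s_eq by (intro cpoly.subspace_diff[OF sub] e_mult ideal[of "e \<zeta> * s - e \<zeta> * g \<zeta>"]) simp_all
    then have inU: "e \<zeta> * g \<zeta> \<in> U"
      by simp
    \<comment> \<open>The order of \<open>e \<zeta> * g \<zeta>\<close> at \<open>\<zeta>\<close> is the smallest gap that occurs with a nonzero coefficient.\<close>
    define m where "m = (LEAST k. k \<in> local_gaps U \<zeta> \<and> c (\<zeta>, k) \<noteq> 0)"
    have m: "m \<in> local_gaps U \<zeta>" "c (\<zeta>, m) \<noteq> 0"
      using LeastI[of "\<lambda>k. k \<in> local_gaps U \<zeta> \<and> c (\<zeta>, k) \<noteq> 0" k] k \<open>c (\<zeta>, k) \<noteq> 0\<close>
      unfolding m_def by auto
    have m_least: "m \<le> k" if "k \<in> local_gaps U \<zeta>" "c (\<zeta>, k) \<noteq> 0" for k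
      unfolding m_def using that by (intro Least_le) auto
    define h where "h = (\<Sum>k\<in>local_gaps U \<zeta>. smult (c (\<zeta>, k)) (lin \<zeta> ^ (k - m)))"
    have "g \<zeta> = lin \<zeta> ^ m * h"
      unfolding g_def h_def sum_distrib_left
    proof (rule sum.cong)
      fix k assume k: "k \<in> local_gaps U \<zeta>"
      show "smult (c (\<zeta>, k)) (lin \<zeta> ^ k) = lin \<zeta> ^ m * smult (c (\<zeta>, k)) (lin \<zeta> ^ (k - m))"
        using m_least[OF k] by (cases "c (\<zeta>, k) = 0") (simp_all flip: power_add)
    qed simp
    then have "lin \<zeta> ^ m * (e \<zeta> * h) \<in> U"
      using inU by (simp add: mult_ac)
    moreover have "poly h \<zeta> = c (\<zeta>, m)"
    proof -
      have "poly h \<zeta> = (\<Sum>k\<in>local_gaps U \<zeta>. if k = m then c (\<zeta>, k) else 0)"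
        unfolding h_def poly_sum
      proof (rule sum.cong)
        fix k assume k: "k \<in> local_gaps U \<zeta>"
        show "poly (smult (c (\<zeta>, k)) (lin \<zeta> ^ (k - m))) \<zeta> = (if k = m then c (\<zeta>, k) else 0)"
          using m_least[OF k] by (cases "c (\<zeta>, k) = 0"; cases "k = m") (auto simp: poly_power)
      qed simp
      then show ?thesis
        using m fin_gaps[OF \<zeta>] by simp
    qed
    \<comment> \<open>Here \<open>n > 0\<close> is essential; it follows from the existence of the gap \<open>k < n\<close>.\<close>
    moreover have "poly (e \<zeta>) \<zeta> = 1"
    proof -
      have "lin \<zeta> ^ 1 dvd lin \<zeta> ^ n"
        using bound[OF k \<zeta>] by (intro le_imp_power_dvd) auto
      then have "lin \<zeta> dvd e \<zeta> - 1"
        using e_self[OF \<zeta>] by (auto intro: dvd_trans)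
      then show ?thesis
        by (simp flip: poly_eq_0_iff_dvd)
    qed
    ultimately show False
      using ord[of \<zeta> m "e \<zeta> * h"] m by simp
  qed

  have inj: "inj_on b A"
  proof (rule inj_onI, rule ccontr)
    fix x y assume xy: "x \<in> A" "y \<in> A" "b x = b y" "x \<noteq> y"
    define c where "c z = (if z = x then 1 else if z = y then - 1 else 0 :: complex)" for z
    have "(\<Sum>z\<in>A. smult (c z) (b z)) = (\<Sum>z\<in>{x, y}. smult (c z) (b z))"
      using finA xy by (intro sum.mono_neutral_right) (auto simp: c_def)
    also have "\<dots> = 0"
      using xy by (simp add: c_def)
    finally have "(\<Sum>z\<in>A. smult (c z) (b z)) \<in> U"
      using sub by (simp add: cpoly.subspace_0)
    then have "c x = 0"
      using indep xy by (cases x) (auto simp: A_def)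
    then show False
      by (simp add: c_def)
  qed
  have zero: "c v = 0" if s: "(\<Sum>v\<in>b ` A. smult (c v) v) \<in> U" and v: "v \<in> b ` A" for c v
  proof -
    have "(\<Sum>x\<in>A. smult (c (b x)) (b x)) \<in> U"
      using s by (simp add: sum.reindex[OF inj])
    then show ?thesis
      using indep[of "c \<circ> b"] v by (auto simp: A_def)
  qed
  have independent: "cpoly.independent (b ` A)"
    using zero finA sub by (auto simp: cpoly.dependent_finite cpoly.subspace_0)
  have trivial: "cpoly.span (b ` A) \<inter> U = {0}"
  proof -
    have "v = 0" if v: "v \<in> cpoly.span (b ` A)" "v \<in> U" for v
    proof -
      obtain c where c: "v = (\<Sum>v\<in>b ` A. smult (c v) v)"
        using v finA by (auto simp: cpoly.span_finite)
      then have "c w = 0" if "w \<in> b ` A" for w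
        using zero[OF _ that] v(2) by blast
      then show ?thesis
        unfolding c by (intro sum.neutral) simp
    qed
    then show ?thesis
      using sub cpoly.span_zero by (auto simp: cpoly.subspace_0)
  qed

  \<comment> \<open>The order of \<open>f\<close> at \<open>\<zeta>\<close> is raised step by step until it reaches \<open>n\<close>.\<close>
  have spanning_local: "\<exists>v\<in>cpoly.span (b ` A). e \<zeta> * f - v \<in> U"
    if "\<zeta> \<in> Z" "m \<le> n" "lin \<zeta> ^ (n - m) dvd f" for \<zeta> m f
    using that
  proof (induction m arbitrary: f)
    case 0
    have "node_poly Z ^ n dvd e \<zeta> * f"
    proof (rule node_poly_power_dvd[OF fin])
      fix \<omega> assume "\<omega> \<in> Z"
      then show "lin \<omega> ^ n dvd e \<zeta> * f"
        using 0 e_other by (cases "\<omega> = \<zeta>") auto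
    qed
    then show ?case
      using ideal cpoly.span_zero by (intro bexI[of _ 0]) auto
  next
    case (Suc m)
    define k where "k = n - Suc m"
    have nm: "n - m = Suc k"
      using Suc by (simp add: k_def)
    obtain g where f: "f = lin \<zeta> ^ k * g"
      using Suc.prems k_def by (auto elim: dvdE)
    show ?case
    proof (cases "k \<in> local_gaps U \<zeta>")
      case True
      define f' where "f' = f - smult (poly g \<zeta>) (lin \<zeta> ^ k)"
      have "lin \<zeta> dvd g - [:poly g \<zeta>:]"
        by (simp flip: poly_eq_0_iff_dvd)
      moreover have "f' = lin \<zeta> ^ k * (g - [:poly g \<zeta>:])"
        by (simp add: f'_def f algebra_simps)
      ultimately have "lin \<zeta> ^ (n - m) dvd f'"
        unfolding nm power_Suc2 by (simp only: mult_dvd_mono dvd_refl)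
      then obtain v where v: "v \<in> cpoly.span (b ` A)" "e \<zeta> * f' - v \<in> U"
        using Suc by auto
      have "e \<zeta> * lin \<zeta> ^ k \<in> b ` A"
        using True Suc.prems by (force simp: A_def b_def)
      then have "v + smult (poly g \<zeta>) (e \<zeta> * lin \<zeta> ^ k) \<in> cpoly.span (b ` A)"
        by (intro cpoly.span_add[OF v(1)] cpoly.span_scale cpoly.span_base)
      moreover have "e \<zeta> * f - (v + smult (poly g \<zeta>) (e \<zeta> * lin \<zeta> ^ k)) \<in> U"
        using v(2) by (simp add: f'_def right_diff_distrib diff_diff_add add.commute)
      ultimately show ?thesis
        by blast
    next
      case False
      then obtain y where y: "y \<in> U" "y \<noteq> 0" "order \<zeta> y = k"
        by (auto simp: local_gaps_def)
      obtain r where r: "y = lin \<zeta> ^ k * r" "poly r \<zeta> \<noteq> 0"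
        using order_decomp[OF y(2), of \<zeta>] y(3) by (auto simp: poly_eq_0_iff_dvd)
      define a where "a = poly g \<zeta> / poly r \<zeta>"
      define f' where "f' = f - smult a y"
      have "lin \<zeta> dvd g - smult a r"
        using r by (simp add: a_def flip: poly_eq_0_iff_dvd)
      moreover have "f' = lin \<zeta> ^ k * (g - smult a r)"
        by (simp add: f'_def f r algebra_simps)
      ultimately have "lin \<zeta> ^ (n - m) dvd f'"
        unfolding nm power_Suc2 by (simp only: mult_dvd_mono dvd_refl)
      then obtain v where v: "v \<in> cpoly.span (b ` A)" "e \<zeta> * f' - v \<in> U"
        using Suc by auto
      have "e \<zeta> * f - v = (e \<zeta> * f' - v) + smult a (e \<zeta> * y)"
        by (simp add: f'_def algebra_simps)
      also have "\<dots> \<in> U"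
        using sub v y by (intro cpoly.subspace_add cpoly.subspace_scale e_mult)
      finally show ?thesis
        using v by blast
    qed
  qed
  have spanning: "\<exists>v\<in>cpoly.span (b ` A). f - v \<in> U" for f
  proof -
    have "\<exists>v\<in>cpoly.span (b ` A). e \<zeta> * f - v \<in> U" if "\<zeta> \<in> Z" for \<zeta>
      using spanning_local[OF that, of n] by simp
    then obtain v where v: "\<And>\<zeta>. \<zeta> \<in> Z \<Longrightarrow> v \<zeta> \<in> cpoly.span (b ` A) \<and> e \<zeta> * f - v \<zeta> \<in> U"
      by metis
    have "node_poly Z ^ n dvd f - (\<Sum>\<zeta>\<in>Z. e \<zeta> * f)"
    proof (rule node_poly_power_dvd[OF fin])
      fix \<omega> assume \<omega>: "\<omega> \<in> Z"
      have eq: "f - (\<Sum>\<zeta>\<in>Z. e \<zeta> * f) = - ((e \<omega> - 1) * f) - (\<Sum>\<zeta>\<in>Z - {\<omega>}. e \<zeta> * f)"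
        using fin \<omega> by (simp add: sum.remove[of Z \<omega>] algebra_simps)
      show "lin \<omega> ^ n dvd f - (\<Sum>\<zeta>\<in>Z. e \<zeta> * f)"
        unfolding eq using \<omega> e_self e_other
        by (intro dvd_diff dvd_sum dvd_mult2) (auto simp: dvd_mult2)
    qed
    then have "f - (\<Sum>\<zeta>\<in>Z. e \<zeta> * f) \<in> U"
      by (rule ideal)
    moreover have "(\<Sum>\<zeta>\<in>Z. e \<zeta> * f - v \<zeta>) \<in> U"
      using sub v by (intro cpoly.subspace_sum) auto
    ultimately have "(f - (\<Sum>\<zeta>\<in>Z. e \<zeta> * f)) + (\<Sum>\<zeta>\<in>Z. e \<zeta> * f - v \<zeta>) \<in> U"
      by (rule cpoly.subspace_add[OF sub])
    then have "f - (\<Sum>\<zeta>\<in>Z. v \<zeta>) \<in> U"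
      by (simp add: sum_subtractf)
    moreover have "(\<Sum>\<zeta>\<in>Z. v \<zeta>) \<in> cpoly.span (b ` A)"
      using v by (intro cpoly.span_sum) auto
    ultimately show ?thesis
      by blast
  qed
  have "card (b ` A) = card A"
    by (rule card_image[OF inj])
  also have "\<dots> = (\<Sum>\<zeta>\<in>Z. card (local_gaps U \<zeta>))"
    unfolding A_def using fin fin_gaps by (simp add: card_SigmaI)
  finally have "card (b ` A) = (\<Sum>\<zeta>\<in>Z. card (local_gaps U \<zeta>))" .
  then show "has_codim U (\<Sum>\<zeta>\<in>Z. card (local_gaps U \<zeta>))"
    unfolding has_codim_def using finA independent trivial spanning by blast
qed

section \<open>Clearing the denominators of the operator\<close>

lemma not_fract_pole_iff:
  "\<not> fract_pole f \<zeta> \<longleftrightarrow> (\<exists>a b. poly b \<zeta> \<noteq> 0 \<and> to_fract b * f = to_fract a)"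
proof -
  define a b where "a = fst (quot_of_fract f)" and "b = snd (quot_of_fract f)"
  have b: "b \<noteq> 0" "coprime b a"
    unfolding a_def b_def using coprime_quot_of_fract[of f] by (auto simp: coprime_commute)
  have "Fract a b = f"
    by (simp add: a_def b_def)
  then have f: "to_fract b * f = to_fract a"
    using b by (auto simp: Fract_conv_to_fract)
  have "poly b \<zeta> \<noteq> 0" if "poly d \<zeta> \<noteq> 0" "to_fract d * f = to_fract c" for c d
  proof -
    have "to_fract (d * a) = to_fract (c * b)"
      using that(2) f by (simp flip: f)
    then have "d * a = c * b"
      by (simp only: to_fract_eq_iff)
    then have "b dvd d * a"
      by simp
    then have "b dvd d"
      using b by (simp add: coprime_dvd_mult_left_iff)
    then show ?thesis
      using that(1) by auto
  qed
  then show ?thesis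
    using f by (auto simp: fract_pole_def b_def)
qed

text \<open>
  Over \<open>\<complex>\<close> a polynomial is determined up to a unit by its roots and their multiplicities, and the latter are
  at most the degree.
\<close>

lemma dvd_node_poly_power:
  assumes "d \<noteq> 0" and "finite Z" and "\<And>\<zeta>. poly d \<zeta> = 0 \<Longrightarrow> \<zeta> \<in> Z"
  shows "d dvd node_poly Z ^ degree d"
proof -
  have "(\<Prod>\<zeta> | poly d \<zeta> = 0. lin \<zeta> ^ order \<zeta> d) dvd (\<Prod>\<zeta> | poly d \<zeta> = 0. lin \<zeta> ^ degree d)"
    using assms by (intro prod_dvd_prod le_imp_power_dvd order_degree)
  also have "\<dots> dvd (\<Prod>\<zeta>\<in>Z. lin \<zeta> ^ degree d)"
    using assms by (intro prod_dvd_prod_subset) auto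
  finally have "smult (lead_coeff d) (\<Prod>\<zeta> | poly d \<zeta> = 0. lin \<zeta> ^ order \<zeta> d) dvd
      (\<Prod>\<zeta>\<in>Z. lin \<zeta> ^ degree d)"
    using assms by (intro smult_dvd) auto
  then show ?thesis
    by (simp only: complex_poly_decompose prod_power_distrib)
qed

definition clears_denominators :: "diff_op \<Rightarrow> complex poly \<Rightarrow> bool" where
  "clears_denominators T d \<longleftrightarrow>
     (\<forall>f \<in> {coeff2 T, coeff1 T, coeff0 T}. \<exists>a. to_fract d * f = to_fract a)"

lemma ex_clears_denominators:
  "\<exists>m. clears_denominators T (node_poly (poles T) ^ m)"
proof -
  let ?F = "{coeff2 T, coeff1 T, coeff0 T}"
  define d where "d = (\<Prod>f\<in>?F. snd (quot_of_fract f))"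
  have "d dvd node_poly (poles T) ^ degree d"
  proof (rule dvd_node_poly_power)
    show "d \<noteq> 0"
      unfolding d_def by (simp only: prod_zero_iff finite_insert finite.emptyI) auto
    show "\<zeta> \<in> poles T" if "poly d \<zeta> = 0" for \<zeta>
    proof -
      have "\<exists>f\<in>?F. fract_pole f \<zeta>"
        using that unfolding d_def poly_prod fract_pole_def by (subst (asm) prod_zero_iff) auto
      then show ?thesis
        by (auto simp: poles_def)
    qed
  qed (rule finite_poles)
  moreover have "\<exists>a. to_fract D * f = to_fract a" if "f \<in> ?F" "d dvd D" for f D
  proof -
    have "snd (quot_of_fract f) dvd d"
      unfolding d_def using that by (intro dvd_prodI) auto
    then obtain g where "D = snd (quot_of_fract f) * g"
      using \<open>d dvd D\<close> by (meson dvdE dvd_trans)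
    moreover have "to_fract (snd (quot_of_fract f)) * f = to_fract (fst (quot_of_fract f))"
    proof -
      have "Fract (fst (quot_of_fract f)) (snd (quot_of_fract f)) = f"
        by simp
      then show ?thesis
        by (metis Fract_conv_to_fract nonzero_mult_div_cancel_left snd_quot_of_fract_nonzero
            times_divide_eq_right to_fract_eq_0_iff)
    qed
    ultimately have "to_fract D * f = to_fract (fst (quot_of_fract f) * g)"
      by (simp add: mult_ac)
    then show ?thesis
      by blast
  qed
  ultimately show ?thesis
    unfolding clears_denominators_def by blast
qed

text \<open>
  Applied to the derivatives of a polynomial, this says that \<open>T\<close> lowers the exponent of \<open>h\<close> by a bounded
  amount; it is stated for independent arguments because it is also used for the commutator of \<open>T\<close> with
  the multiplication by a polynomial.
\<close>

lemma coeff_combination_dvd: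
  assumes "clears_denominators T (h ^ m)"
    and "h ^ (N + m) dvd f2" "h ^ (N + m) dvd f1" "h ^ (N + m) dvd f0"
  shows "\<exists>u. h ^ N dvd u \<and>
    coeff2 T * to_fract f2 + coeff1 T * to_fract f1 + coeff0 T * to_fract f0 = to_fract u"
proof -
  have "\<exists>u. h ^ N dvd u \<and> c * to_fract f = to_fract u"
    if c: "c \<in> {coeff2 T, coeff1 T, coeff0 T}" and dvd: "h ^ (N + m) dvd f" for c f
  proof -
    obtain a where a: "to_fract (h ^ m) * c = to_fract a"
      using bspec[OF assms(1)[unfolded clears_denominators_def] c] by blast
    obtain g where f: "f = h ^ (N + m) * g"
      using dvd by (elim dvdE)
    have "c * to_fract f = (to_fract (h ^ m) * c) * to_fract (h ^ N * g)"
      by (simp add: f power_add mult_ac)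
    also have "\<dots> = to_fract (h ^ N * (g * a))"
      unfolding a by (simp add: mult_ac)
    finally show ?thesis
      by (metis dvd_triv_left)
  qed
  note * = this
  obtain u2 u1 u0 where
    "h ^ N dvd u2" "coeff2 T * to_fract f2 = to_fract u2"
    "h ^ N dvd u1" "coeff1 T * to_fract f1 = to_fract u1"
    "h ^ N dvd u0" "coeff0 T * to_fract f0 = to_fract u0"
    using *[OF _ assms(2), of "coeff2 T"] *[OF _ assms(3), of "coeff1 T"]
      *[OF _ assms(4), of "coeff0 T"] by auto
  then show ?thesis
    by (intro exI[of _ "u2 + u1 + u0"]) auto
qed

section \<open>The maximal invariant subspace as an intersection\<close>

text \<open>
  The polynomials \<open>y\<close> such that \<open>T\<^sup>i[y]\<close> is a polynomial for all \<open>i \<le> j\<close>. The recursion avoids the action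
  of \<open>T\<close> on rational functions.
\<close>

primrec iterates_poly :: "diff_op \<Rightarrow> nat \<Rightarrow> complex poly set" where
  "iterates_poly T 0 = UNIV"
| "iterates_poly T (Suc j) = {y. \<exists>u\<in>iterates_poly T j. app_op T y = to_fract u}"

lemma subspace_iterates_poly: "cpoly.subspace (iterates_poly T j)"
proof (induction j)
  case (Suc j)
  show ?case
  proof (rule cpoly.subspaceI)
    show "0 \<in> iterates_poly T (Suc j)"
      using cpoly.subspace_0[OF Suc] by (auto simp: app_op_def intro!: bexI[of _ 0])
    show "x + y \<in> iterates_poly T (Suc j)"
      if "x \<in> iterates_poly T (Suc j)" "y \<in> iterates_poly T (Suc j)" for x y
      using that cpoly.subspace_add[OF Suc] by (force simp: app_op_add simp flip: to_fract_add)
    show "smult c x \<in> iterates_poly T (Suc j)" if x: "x \<in> iterates_poly T (Suc j)" for c x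
    proof -
      obtain u where u: "u \<in> iterates_poly T j" "app_op T x = to_fract u"
        using x by auto
      then have "app_op T (smult c x) = to_fract (smult c u)"
        by (simp add: app_op_smult flip: to_fract_mult)
      then show ?thesis
        using cpoly.subspace_scale[OF Suc u(1)] by auto
    qed
  qed
qed (simp add: cpoly.subspace_UNIV)

text \<open>
  The intersection is invariant because \<open>T[y]\<close> determines its polynomial \<open>u\<close> uniquely, so that the same
  \<open>u\<close> lies in every member of the chain.
\<close>

lemma max_invariant_subspace_eq_Inter:
  "max_invariant_subspace T = (\<Inter>j. iterates_poly T j)"
proof
  have "max_invariant_subspace T \<subseteq> iterates_poly T j" for j
  proof (induction j)
    case (Suc j)
    show ?case
    proof
      fix y assume "y \<in> max_invariant_subspace T"
      then obtain u where "u \<in> max_invariant_subspace T" "app_op T y = to_fract u"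
        using max_invariant_subspace(1)[of T] by (auto simp: invariant_poly_subspace_def)
      then show "y \<in> iterates_poly T (Suc j)"
        using Suc by auto
    qed
  qed simp
  then show "max_invariant_subspace T \<subseteq> (\<Inter>j. iterates_poly T j)"
    by blast
  have "\<exists>u\<in>(\<Inter>j. iterates_poly T j). app_op T y = to_fract u"
    if y: "y \<in> (\<Inter>j. iterates_poly T j)" for y
  proof -
    have step: "\<exists>u\<in>iterates_poly T j. app_op T y = to_fract u" for j
      using INT_D[OF y, of "Suc j"] by simp
    obtain u where u: "app_op T y = to_fract u"
      using step[of 0] by blast
    have "u \<in> iterates_poly T j" for j
      using step[of j] u by auto
    then show ?thesis
      using u by blast
  qed
  then show "(\<Inter>j. iterates_poly T j) \<subseteq> max_invariant_subspace T"
    by (intro max_invariant_subspace(2))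
      (force simp: invariant_poly_subspace_def intro!: cpoly.subspace_Inter subspace_iterates_poly)
qed

lemma high_power_dvd_imp_iterates_poly:
  assumes "clears_denominators T (h ^ m)"
  shows "\<exists>N. \<forall>y. h ^ N dvd y \<longrightarrow> y \<in> iterates_poly T j"
proof (induction j)
  case (Suc j)
  then obtain N where N: "\<And>y. h ^ N dvd y \<Longrightarrow> y \<in> iterates_poly T j"
    by blast
  have "y \<in> iterates_poly T (Suc j)" if y: "h ^ Suc (Suc (N + m)) dvd y" for y
  proof -
    have y1: "h ^ Suc (N + m) dvd pderiv y"
      using y by (rule power_dvd_pderiv)
    then have y2: "h ^ (N + m) dvd pderiv (pderiv y)"
      by (rule power_dvd_pderiv)
    have "\<exists>u. h ^ N dvd u \<and> app_op T y = to_fract u"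
      unfolding app_op_def using y y1 y2
      by (intro coeff_combination_dvd[OF assms]) (auto intro: power_le_dvd)
    then show ?thesis
      using N by auto
  qed
  then show ?case
    by blast
qed simp

text \<open>
  The commutator of \<open>T = p D\<^sub>z\<^sub>z + q D\<^sub>z + r\<close> with the multiplication by \<open>e\<close> is
  \<open>y \<mapsto> p (e'' y + 2 e' y') + q e' y\<close>. It involves \<open>e\<close> only through its derivatives, so if these are divisible
  by a high power of \<open>h\<close>, then \<open>T[e y]\<close> equals \<open>e T[y]\<close> up to a polynomial on which \<open>T\<close> can be iterated \<open>j\<close>
  times.
\<close>

lemma iterates_poly_mult_locally_constant:
  assumes "clears_denominators T (h ^ m)"
  shows "\<exists>N. \<forall>e y. h ^ N dvd pderiv e \<longrightarrow> y \<in> iterates_poly T j \<longrightarrow> e * y \<in> iterates_poly T j"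
proof (induction j)
  case (Suc j)
  then obtain N where N:
    "\<And>e y. h ^ N dvd pderiv e \<Longrightarrow> y \<in> iterates_poly T j \<Longrightarrow> e * y \<in> iterates_poly T j"
    by blast
  obtain M where M: "\<And>y. h ^ M dvd y \<Longrightarrow> y \<in> iterates_poly T j"
    using high_power_dvd_imp_iterates_poly[OF assms] by blast
  have "e * y \<in> iterates_poly T (Suc j)"
    if e: "h ^ (N + Suc (M + m)) dvd pderiv e" and y: "y \<in> iterates_poly T (Suc j)" for e y
  proof -
    obtain u where u: "u \<in> iterates_poly T j" "app_op T y = to_fract u"
      using y by auto
    have e1: "h ^ Suc (M + m) dvd pderiv e" "h ^ (M + m) dvd pderiv e" "h ^ N dvd pderiv e"
      using e by (rule power_le_dvd; simp)+
    have e2: "h ^ (M + m) dvd pderiv (pderiv e)"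
      using e1(1) by (rule power_dvd_pderiv)
    have "\<exists>w. h ^ M dvd w \<and>
      coeff2 T * to_fract (pderiv (pderiv e) * y + 2 * pderiv e * pderiv y)
        + coeff1 T * to_fract (pderiv e * y) + coeff0 T * to_fract 0 = to_fract w"
      using e1 e2 by (intro coeff_combination_dvd[OF assms]) (auto intro: dvd_add)
    then obtain w where w: "h ^ M dvd w"
      "coeff2 T * to_fract (pderiv (pderiv e) * y + 2 * pderiv e * pderiv y)
        + coeff1 T * to_fract (pderiv e * y) = to_fract w"
      by auto
    have two: "to_fract (2 :: complex poly) = 2"
      by (metis one_add_one to_fract_1 to_fract_add)
    have "app_op T (e * y) = to_fract e * app_op T y + to_fract w"
      unfolding w(2)[symmetric] app_op_def by (simp add: pderiv_mult pderiv_add algebra_simps two)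
    also have "\<dots> = to_fract (e * u + w)"
      by (simp add: u)
    finally have "app_op T (e * y) = to_fract (e * u + w)" .
    moreover have "e * u + w \<in> iterates_poly T j"
      using N[OF e1(3) u(1)] M[OF w(1)] by (rule cpoly.subspace_add[OF subspace_iterates_poly])
    ultimately show ?thesis
      unfolding iterates_poly.simps by blast
  qed
  then show ?case
    by blast
qed simp

section \<open>An ideal inside the maximal invariant subspace\<close>

text \<open>Leading terms are removed by elements of \<open>V\<close> until nothing is left.\<close>

lemma subspace_subset_if_degrees_subset:
  assumes V: "cpoly.subspace V" and W: "cpoly.subspace W" and "V \<subseteq> W"
    and deg: "\<And>w. w \<in> W \<Longrightarrow> w \<noteq> 0 \<Longrightarrow> \<exists>v\<in>V. v \<noteq> 0 \<and> degree v = degree w"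
  shows "W \<subseteq> V"
proof -
  have "w \<in> V" if "w \<in> W" for w
    using that
  proof (induction "degree w" arbitrary: w rule: less_induct)
    case less
    show ?case
    proof (cases "w = 0")
      case True
      then show ?thesis
        using V by (simp add: cpoly.subspace_0)
    next
      case False
      then obtain v where v: "v \<in> V" "v \<noteq> 0" "degree v = degree w"
        using deg less by blast
      define a where "a = lead_coeff w / lead_coeff v"
      define v' where "v' = smult a v"
      have "lead_coeff v \<noteq> 0" "lead_coeff w \<noteq> 0"
        using v(2) False by (simp_all only: leading_coeff_0_iff not_False_eq_True)
      then have a: "a \<noteq> 0" "a * lead_coeff v = lead_coeff w"
        by (auto simp: a_def)
      have v': "v' \<in> V" "degree v' = degree w" "lead_coeff v' = lead_coeff w"
        using v V a by (auto simp: v'_def cpoly.subspace_scale)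
      have "w - v' \<in> V"
      proof (cases "w - v' = 0")
        case True
        then show ?thesis
          using V by (simp only: cpoly.subspace_0)
      next
        case False
        have "coeff (w - v') (degree w) = 0"
          using v' by simp
        moreover have "degree (w - v') \<le> degree w"
          using v' by (intro degree_diff_le) auto
        ultimately have "degree (w - v') < degree w"
          using False eq_zero_or_degree_less by blast
        then show ?thesis
          using less v' W \<open>V \<subseteq> W\<close> by (blast intro: cpoly.subspace_diff)
      qed
      then have "(w - v') + v' \<in> V"
        using v' V by (intro cpoly.subspace_add)
      then show ?thesis
        by simp
    qed
  qed
  then show ?thesis
    by blast
qed

text \<open>
  The subspaces \<open>U + (h\<^sup>N)\<close> decrease with \<open>N\<close>, and the degrees of their elements can differ only within the
  finite set \<open>K\<close>. Hence their sets of degrees become stationary, and by the previous lemma so do the subspaces.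
\<close>

lemma subspace_plus_powers_stabilise:
  assumes U: "cpoly.subspace U" and K: "finite K"
    and deg: "\<And>k. k \<notin> K \<Longrightarrow> \<exists>y\<in>U. y \<noteq> 0 \<and> degree y = k"
  shows "\<exists>n. \<forall>N f. h ^ n dvd f \<longrightarrow> (\<exists>y\<in>U. h ^ N dvd f - y)"
proof -
  define W where "W N = {w. \<exists>y\<in>U. h ^ N dvd w - y}" for N
  have WI: "w \<in> W N" if "y \<in> U" "h ^ N dvd w - y" for w y N
    using that unfolding W_def by blast
  have subW: "cpoly.subspace (W N)" for N
  proof (rule cpoly.subspaceI)
    show "0 \<in> W N"
      using cpoly.subspace_0[OF U] by (rule WI) simp
    show "x + y \<in> W N" if xy: "x \<in> W N" "y \<in> W N" for x y
    proof -
      obtain a b where "a \<in> U" "h ^ N dvd x - a" "b \<in> U" "h ^ N dvd y - b"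
        using xy unfolding W_def by blast
      then have "a + b \<in> U" "h ^ N dvd (x + y) - (a + b)"
        unfolding add_diff_add by (blast intro: cpoly.subspace_add[OF U], intro dvd_add)
      then show ?thesis
        by (rule WI)
    qed
    show "smult c x \<in> W N" if x: "x \<in> W N" for c x
    proof -
      obtain a where a: "a \<in> U" "h ^ N dvd x - a"
        using x unfolding W_def by blast
      have "h ^ N dvd smult c x - smult c a"
        unfolding smult_diff_right[symmetric] using a by (intro dvd_smult)
      then show ?thesis
        by (rule WI[OF cpoly.subspace_scale[OF U a(1)]])
    qed
  qed
  have UW: "U \<subseteq> W N" for N
    by (auto intro: WI)
  have mono: "W N \<subseteq> W n" if "n \<le> N" for n N
    using that unfolding W_def by (blast intro: power_le_dvd)
  define D where "D N = {degree w | w. w \<in> W N \<and> w \<noteq> 0} \<inter> K" for N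
  have finD: "finite (D N)" for N
    using K by (simp add: D_def)
  define n where "n = (ARG_MIN (\<lambda>N. card (D N)) N. True)"
  have min: "card (D n) \<le> card (D N)" for N
    unfolding n_def by (rule arg_min_nat_le) simp
  have "W n \<subseteq> W N" for N
  proof (cases "n \<le> N")
    case True
    have "D N \<subseteq> D n"
      using mono[OF True] by (auto simp: D_def)
    then have D: "D N = D n"
      using min finD by (intro card_seteq) auto
    show ?thesis
    proof (rule subspace_subset_if_degrees_subset[OF subW subW mono[OF True]])
      fix w assume w: "w \<in> W n" "w \<noteq> 0"
      show "\<exists>v\<in>W N. v \<noteq> 0 \<and> degree v = degree w"
      proof (cases "degree w \<in> K")
        case True
        then have "degree w \<in> D N"
          using w D by (auto simp: D_def)
        then show ?thesis
          unfolding D_def by auto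
      next
        case False
        then show ?thesis
          using deg[OF False] UW[of N] by blast
      qed
    qed
  qed (simp add: mono)
  moreover have "f \<in> W n" if "h ^ n dvd f" for f
    using cpoly.subspace_0[OF U] by (rule WI) (simp add: that)
  ultimately have "f \<in> W N" if "h ^ n dvd f" for N f
    using that by blast
  then show ?thesis
    by (intro exI[of _ n]) (simp add: W_def)
qed

text \<open>
  The exponent \<open>n\<close> comes from the stationary chain and thus is independent of \<open>j\<close>, whereas the exponent \<open>N\<close>
  beyond which \<open>T\<close> can be iterated \<open>j\<close> times grows with \<open>j\<close>; the chain allows passing from \<open>n\<close> to \<open>N\<close> modulo
  \<open>U\<close>.
\<close>

lemma max_invariant_subspace_contains_ideal:
  assumes "exceptional T" and "clears_denominators T (h ^ m)"
  shows "\<exists>n. \<forall>f. h ^ n dvd f \<longrightarrow> f \<in> max_invariant_subspace T"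
proof -
  let ?U = "max_invariant_subspace T"
  have U: "cpoly.subspace ?U"
    using max_invariant_subspace(1) by (simp add: invariant_poly_subspace_def)
  obtain K where K: "finite K" "\<And>k. k \<notin> K \<Longrightarrow> has_eigenpoly T k"
    using assms(1) by (auto simp: exceptional_def)
  have deg: "\<exists>y\<in>?U. y \<noteq> 0 \<and> degree y = k" if k: "k \<notin> K" for k
  proof -
    obtain y c where y: "y \<noteq> 0" "degree y = k" "app_op T y = to_fract (smult c y)"
      using K(2)[OF k] by (auto simp: has_eigenpoly_def)
    have "app_op T (smult a y) = to_fract (smult (a * c) y)" for a
      by (simp add: app_op_smult y flip: to_fract_mult)
    then have "invariant_poly_subspace T (cpoly.span {y})"
      unfolding invariant_poly_subspace_def
      by (intro conjI cpoly.subspace_span) (auto simp: cpoly.span_singleton)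
    then have "y \<in> ?U"
      using max_invariant_subspace(2) cpoly.span_base by blast
    then show ?thesis
      using y by blast
  qed
  obtain n where n: "\<And>N f. h ^ n dvd f \<Longrightarrow> \<exists>y\<in>?U. h ^ N dvd f - y"
    using subspace_plus_powers_stabilise[OF U K(1) deg] by blast
  have "f \<in> iterates_poly T j" if f: "h ^ n dvd f" for f j
  proof -
    obtain N where N: "\<And>y. h ^ N dvd y \<Longrightarrow> y \<in> iterates_poly T j"
      using high_power_dvd_imp_iterates_poly[OF assms(2)] by blast
    obtain y where y: "y \<in> ?U" "h ^ N dvd f - y"
      using n[OF f] by blast
    then have "y + (f - y) \<in> iterates_poly T j"
      using N by (intro cpoly.subspace_add subspace_iterates_poly)
        (auto simp: max_invariant_subspace_eq_Inter)
    then show ?thesis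
      by simp
  qed
  then show ?thesis
    by (auto simp: max_invariant_subspace_eq_Inter)
qed

text \<open>
  For each \<open>j\<close>, the multiplier \<open>e\<close> is replaced by an \<open>e'\<close> that is constant to an order depending on \<open>j\<close> at all
  nodes, with the same constants. Since \<open>e - e'\<close> is divisible by the \<open>n\<close>-th power of the node polynomial,
  this changes \<open>e y\<close> only by an element of the maximal invariant subspace.
\<close>

lemma max_invariant_subspace_mult_locally_constant:
  assumes fin: "finite Z" and clears: "clears_denominators T (node_poly Z ^ m)"
    and ideal: "\<And>f. node_poly Z ^ n dvd f \<Longrightarrow> f \<in> max_invariant_subspace T"
    and y: "y \<in> max_invariant_subspace T"
    and e: "\<And>\<zeta>. \<zeta> \<in> Z \<Longrightarrow> \<exists>c. lin \<zeta> ^ n dvd e - [:c:]"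
  shows "e * y \<in> max_invariant_subspace T"
proof -
  obtain c where c: "\<And>\<zeta>. \<zeta> \<in> Z \<Longrightarrow> lin \<zeta> ^ n dvd e - [:c \<zeta>:]"
    using e by metis
  have "e * y \<in> iterates_poly T j" for j
  proof -
    obtain N where N: "\<And>e y. node_poly Z ^ N dvd pderiv e \<Longrightarrow> y \<in> iterates_poly T j \<Longrightarrow>
        e * y \<in> iterates_poly T j"
      using iterates_poly_mult_locally_constant[OF clears] by blast
    obtain e' where e': "\<And>\<zeta>. \<zeta> \<in> Z \<Longrightarrow> lin \<zeta> ^ (n + Suc N) dvd e' - [:c \<zeta>:]"
      using chinese_remainder_lin[OF fin] by meson
    have "node_poly Z ^ N dvd pderiv e'"
    proof (rule node_poly_power_dvd[OF fin])
      fix \<zeta> assume "\<zeta> \<in> Z"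
      then have "lin \<zeta> ^ Suc N dvd e' - [:c \<zeta>:]"
        by (rule power_le_dvd[OF e']) simp
      then have "lin \<zeta> ^ N dvd pderiv (e' - [:c \<zeta>:])"
        by (rule power_dvd_pderiv)
      then show "lin \<zeta> ^ N dvd pderiv e'"
        by (simp add: pderiv_diff pderiv_pCons)
    qed
    then have "e' * y \<in> iterates_poly T j"
      using N y by (auto simp: max_invariant_subspace_eq_Inter)
    moreover have "(e - e') * y \<in> iterates_poly T j"
    proof -
      have "node_poly Z ^ n dvd e - e'"
      proof (rule node_poly_power_dvd[OF fin])
        fix \<zeta> assume \<zeta>: "\<zeta> \<in> Z"
        have "lin \<zeta> ^ n dvd e' - [:c \<zeta>:]"
          by (rule power_le_dvd[OF e'[OF \<zeta>]]) simp
        with c[OF \<zeta>] have "lin \<zeta> ^ n dvd (e - [:c \<zeta>:]) - (e' - [:c \<zeta>:])"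
          by (rule dvd_diff)
        then show "lin \<zeta> ^ n dvd e - e'"
          by simp
      qed
      then have "(e - e') * y \<in> max_invariant_subspace T"
        by (intro ideal dvd_mult2)
      then show ?thesis
        by (auto simp: max_invariant_subspace_eq_Inter)
    qed
    ultimately have "e' * y + (e - e') * y \<in> iterates_poly T j"
      by (intro cpoly.subspace_add subspace_iterates_poly)
    then show ?thesis
      by (simp add: algebra_simps)
  qed
  then show ?thesis
    by (simp add: max_invariant_subspace_eq_Inter)
qed

section \<open>Regularity of the coefficients at points without gaps\<close>

text \<open>
  Cramer's rule for the leading coefficient \<open>p\<close> in the linear system \<open>p c\<^sub>i + q b\<^sub>i + r a\<^sub>i = t\<^sub>i\<close>, \<open>i = 0, 1, 2\<close>.
\<close>

lemma cramer_elimination: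
  fixes p q r :: "'a :: comm_ring_1"
  shows "(c2 * (b1 * a0 - b0 * a1) - c1 * (b2 * a0 - b0 * a2) + c0 * (b2 * a1 - b1 * a2)) * p =
    (p * c2 + q * b2 + r * a2) * (b1 * a0 - b0 * a1) - (p * c1 + q * b1 + r * a1) * (b2 * a0 - b0 * a2)
      + (p * c0 + q * b0 + r * a0) * (b2 * a1 - b1 * a2)"
proof -
  define A B C where "A = b1 * a0 - b0 * a1" and "B = b2 * a0 - b0 * a2" and "C = b2 * a1 - b1 * a2"
  have "(p * c2 + q * b2 + r * a2) * A - (p * c1 + q * b1 + r * a1) * B + (p * c0 + q * b0 + r * a0) * C
      = (c2 * A - c1 * B + c0 * C) * p + q * (b2 * A - b1 * B + b0 * C) + r * (a2 * A - a1 * B + a0 * C)"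
    by (simp add: algebra_simps)
  moreover have "b2 * A - b1 * B + b0 * C = 0" "a2 * A - a1 * B + a0 * C = 0"
    by (simp_all add: A_def B_def C_def algebra_simps)
  ultimately show ?thesis
    by (simp add: A_def B_def C_def)
qed

lemma pderiv_lin_mult: "pderiv (lin \<zeta> * g) = g + lin \<zeta> * pderiv g"
  by (simp add: pderiv_diff pderiv_smult pderiv_pCons)

text \<open>
  Let \<open>y\<^sub>0, y\<^sub>1, y\<^sub>2\<close> be elements of orders \<open>0, 1, 2\<close> at \<open>\<zeta>\<close>. At \<open>\<zeta>\<close>, the matrix with the rows
  \<open>(y\<^sub>i'', y\<^sub>i', y\<^sub>i)\<close> is triangular with respect to its antidiagonal, whose entries are nonzero, so the linear equations
  \<open>T[y\<^sub>i] = u\<^sub>i\<close> can be solved for the coefficients of \<open>T\<close> without dividing by a polynomial that vanishes at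
  \<open>\<zeta>\<close>.
\<close>

lemma not_pole_if_orders_0_1_2:
  assumes gaps: "0 \<notin> local_gaps (max_invariant_subspace T) \<zeta>"
      "1 \<notin> local_gaps (max_invariant_subspace T) \<zeta>"
      "2 \<notin> local_gaps (max_invariant_subspace T) \<zeta>"
  shows "\<zeta> \<notin> poles T"
proof -
  have ex: "\<exists>g u. poly g \<zeta> \<noteq> 0 \<and> app_op T (lin \<zeta> ^ k * g) = to_fract u"
    if k: "k \<notin> local_gaps (max_invariant_subspace T) \<zeta>" for k
  proof -
    obtain y where y: "y \<in> max_invariant_subspace T" "y \<noteq> 0" "order \<zeta> y = k"
      using k by (auto simp: local_gaps_def)
    obtain u where "app_op T y = to_fract u"
      using max_invariant_subspace(1)[of T] y(1) by (auto simp: invariant_poly_subspace_def)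
    then show ?thesis
      using order_decomp[OF y(2), of \<zeta>] y(3) by (auto simp: poly_eq_0_iff_dvd)
  qed
  obtain y0 u0 where y0: "poly y0 \<zeta> \<noteq> 0" and u0: "app_op T y0 = to_fract u0"
    using ex[OF gaps(1)] by auto
  obtain g1 u1 where g1: "poly g1 \<zeta> \<noteq> 0" and u1: "app_op T (lin \<zeta> ^ 1 * g1) = to_fract u1"
    using ex[OF gaps(2)] by auto
  obtain g2 u2 where g2: "poly g2 \<zeta> \<noteq> 0" and u2: "app_op T (lin \<zeta> ^ 2 * g2) = to_fract u2"
    using ex[OF gaps(3)] by auto
  define y1 y2 where "y1 = lin \<zeta> ^ 1 * g1" and "y2 = lin \<zeta> ^ 2 * g2"
  have y1: "poly y1 \<zeta> = 0" "poly (pderiv y1) \<zeta> \<noteq> 0"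
    using g1 unfolding y1_def power_one_right pderiv_lin_mult by simp_all
  have y2: "poly y2 \<zeta> = 0" "poly (pderiv y2) \<zeta> = 0" "poly (pderiv (pderiv y2)) \<zeta> \<noteq> 0"
    using g2 unfolding y2_def power2_eq_square mult.assoc pderiv_lin_mult pderiv_add by simp_all

  have u1: "app_op T y1 = to_fract u1" and u2: "app_op T y2 = to_fract u2"
    unfolding y1_def y2_def by (rule u1, rule u2)

  \<comment> \<open>The Wronskians of \<open>y0, y1\<close> and of \<open>y0, y1, y2\<close>.\<close>
  define w where "w = pderiv y1 * y0 - pderiv y0 * y1"
  define W where "W = pderiv (pderiv y2) * w - pderiv (pderiv y1) * (pderiv y2 * y0 - pderiv y0 * y2)
    + pderiv (pderiv y0) * (pderiv y2 * y1 - pderiv y1 * y2)"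
  have "poly w \<zeta> = poly (pderiv y1) \<zeta> * poly y0 \<zeta>"
    by (simp add: w_def y1(1))
  then have w: "poly w \<zeta> \<noteq> 0"
    using y0 y1(2) by simp
  have "poly W \<zeta> = poly (pderiv (pderiv y2)) \<zeta> * poly w \<zeta>"
    by (simp add: W_def y1(1) y2(1,2))
  then have W: "poly W \<zeta> \<noteq> 0"
    using w y2(3) by simp

  have "to_fract W * coeff2 T = app_op T y2 * to_fract w
      - app_op T y1 * to_fract (pderiv y2 * y0 - pderiv y0 * y2)
      + app_op T y0 * to_fract (pderiv y2 * y1 - pderiv y1 * y2)"
    unfolding app_op_def W_def w_def to_fract_add to_fract_diff to_fract_mult
    by (rule cramer_elimination)
  also have "\<dots> = to_fract (u2 * w - u1 * (pderiv y2 * y0 - pderiv y0 * y2)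
      + u0 * (pderiv y2 * y1 - pderiv y1 * y2))"
    by (simp add: u0 u1 u2)
  finally obtain a2 where a2: "to_fract W * coeff2 T = to_fract a2"
    by blast

  have "to_fract (W * w) * coeff1 T
      = to_fract W * (app_op T y1 * to_fract y0 - app_op T y0 * to_fract y1)
        - (to_fract W * coeff2 T) * to_fract (pderiv (pderiv y1) * y0 - pderiv (pderiv y0) * y1)"
    unfolding app_op_def w_def by (simp add: algebra_simps)
  also have "\<dots> = to_fract (W * (u1 * y0 - u0 * y1)
      - a2 * (pderiv (pderiv y1) * y0 - pderiv (pderiv y0) * y1))"
    unfolding a2 by (simp add: u0 u1)
  finally obtain a1 where a1: "to_fract (W * w) * coeff1 T = to_fract a1"
    by blast

  have "to_fract (W * w * y0) * coeff0 T = to_fract (W * w) * app_op T y0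
      - (to_fract W * coeff2 T) * to_fract (w * pderiv (pderiv y0))
      - (to_fract (W * w) * coeff1 T) * to_fract (pderiv y0)"
    unfolding app_op_def by (simp add: algebra_simps)
  also have "\<dots> = to_fract (W * w * u0 - a2 * (w * pderiv (pderiv y0)) - a1 * pderiv y0)"
    unfolding a1 a2 by (simp add: u0)
  finally obtain a0 where a0: "to_fract (W * w * y0) * coeff0 T = to_fract a0"
    by blast

  have "\<not> fract_pole (coeff2 T) \<zeta>" "\<not> fract_pole (coeff1 T) \<zeta>" "\<not> fract_pole (coeff0 T) \<zeta>"
  proof -
    have "poly (W * w) \<zeta> \<noteq> 0" "poly (W * w * y0) \<zeta> \<noteq> 0"
      using W w y0 by simp_all
    then show "\<not> fract_pole (coeff2 T) \<zeta>" "\<not> fract_pole (coeff1 T) \<zeta>" "\<not> fract_pole (coeff0 T) \<zeta>"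
      unfolding not_fract_pole_iff using a2 a1 a0 W by blast+
  qed
  then show ?thesis
    by (simp add: poles_def)
qed

section \<open>Gaps and poles\<close>

theorem theorem4p15:
  fixes T :: diff_op
  assumes "T \<in> Diff2" and "exceptional T"
  shows "(\<forall>\<zeta>. nu T \<zeta> > 0 \<longleftrightarrow> \<zeta> \<in> poles T) \<and>
    has_codim (max_invariant_subspace T) (\<Sum>\<zeta>\<in>poles T. nu T \<zeta>)"
proof -
  let ?U = "max_invariant_subspace T"
  have nu: "nu T \<zeta> = card (local_gaps ?U \<zeta>)" for \<zeta>
    by (simp add: nu_def order_set_def local_gaps_def Compl_eq_Diff_UNIV)
  have U: "cpoly.subspace ?U"
    using max_invariant_subspace(1) by (simp add: invariant_poly_subspace_def)
  obtain m where m: "clears_denominators T (node_poly (poles T) ^ m)"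
    using ex_clears_denominators by blast
  obtain n where n: "\<And>f. node_poly (poles T) ^ n dvd f \<Longrightarrow> f \<in> ?U"
    using max_invariant_subspace_contains_ideal[OF assms(2) m] by blast
  have mult: "e * y \<in> ?U"
    if "y \<in> ?U" "\<And>\<zeta>. \<zeta> \<in> poles T \<Longrightarrow> \<exists>c. lin \<zeta> ^ n dvd e - [:c:]" for e y
    using that by (intro max_invariant_subspace_mult_locally_constant[OF finite_poles m n])
  have codim: "has_codim ?U (\<Sum>\<zeta>\<in>poles T. card (local_gaps ?U \<zeta>))"
    by (rule has_codim_sum_local_gaps(1)[where n = n, OF finite_poles U], fact n, fact mult)
  have finite_gaps: "finite (local_gaps ?U \<zeta>)" if "\<zeta> \<in> poles T" for \<zeta>
    by (rule has_codim_sum_local_gaps(2)[where n = n, OF finite_poles U _ _ that], fact n, fact mult)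
  have no_gaps: "local_gaps ?U \<zeta> = {}" if "\<zeta> \<notin> poles T" for \<zeta>
    by (rule has_codim_sum_local_gaps(3)[where n = n, OF finite_poles U _ _ that], fact n, fact mult)
  have "nu T \<zeta> > 0 \<longleftrightarrow> \<zeta> \<in> poles T" for \<zeta>
  proof
    show "\<zeta> \<in> poles T" if "nu T \<zeta> > 0"
      using that no_gaps[of \<zeta>] unfolding nu by (metis card.empty less_irrefl)
    show "nu T \<zeta> > 0" if \<zeta>: "\<zeta> \<in> poles T"
      using not_pole_if_orders_0_1_2[of T \<zeta>] \<zeta> finite_gaps[OF \<zeta>] unfolding nu card_gt_0_iff by blast
  qed
  then show ?thesis
    using codim by (simp add: nu)
qed

end
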